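(* Let $p$ be an odd prime, let $m$ be an integer not divisible by $p$, and let $\varepsilon\in\{1,-1\}$. Let $\mathcal A_{p,m,\varepsilon}$ be the set of residue classes $n \bmod p(p-1)$ such that $p^2\mid D_\varepsilon(n,m)$, and let $\mathcal B_{p,m,\varepsilon}$ be the set of ordered pairs $(x \bmod p^2,\ k \bmod p-1)$ such that $x$ is a nonzero $p$th power modulo $p^2$ and $x^k\equiv -\varepsilon(1-x)^m\pmod{p^2}$. Define $\alpha_{p,m,\varepsilon}:\mathcal A_{p,m,\varepsilon}\to\mathcal B_{p,m,\varepsilon}$ by sending $n \bmod p(p-1)$ to the pair consisting of the unique $p$th power $x \bmod p^2$ with $x\equiv 1-mn^{-1}\pmod p$ and of $m-n \bmod p-1$, and define $\beta_{p,m,\varepsilon}:\mathcal B_{p,m,\varepsilon}\to\mathcal A_{p,m,\varepsilon}$ by $\beta_{p,m,\varepsilon}(x,k)=(m-k)p-m(1-x)^{-1}(p-1) \bmod p(p-1)$, where $(1-x)^{-1}$ is an integer inverse of $1-x$ modulo $p^2$. Then these maps are well defined and are mutually inverse bijections; in particular $\mathcal A_{p,m,\varepsilon}$ and $\mathcal B_{p,m,\varepsilon}$ are in one-to-one correspondence.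
   Context: For $\varepsilon\in\{-1,1\}$ and positive integers $n>m$, $D_\varepsilon(n,m)=n^n+\varepsilon (n-m)^{n-m}m^m$. Convention: for a prime $p$ and integers $n,m$ with $p\nmid m$ (not necessarily positive or with $n>m$), "$p^2\mid D_\varepsilon(n,m)$" means $p^2\mid D_\varepsilon(n',m')$ for positive integers $m'\equiv m$, $n'\equiv n \pmod{p(p-1)}$ with $n'>m'$ (this does not depend on the choice of $n',m'$). An integer $x$ is a nonzero $p$th power modulo $p^2$ if $x\equiv a^p\pmod{p^2}$ for some integer $a$ and $p\nmid x$. Powers with negative exponents denote powers of inverses modulo $p^2$. *)

theory Defs
  imports "HOL-Number_Theory.Number_Theory" "HOL-Number_Theory.Modular_Inverse"
begin

definition residue_class :: "int \<Rightarrow> int \<Rightarrow> int set" where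
  "residue_class N a = {b. [b = a] (mod N)}"

text \<open>Used only for \<open>n > m > 0\<close>, where the subtraction of naturals does not truncate.\<close>
definition D :: "int \<Rightarrow> nat \<Rightarrow> nat \<Rightarrow> int" where
  "D \<epsilon> n m = int n ^ n + \<epsilon> * int (n - m) ^ (n - m) * int m ^ m"

text \<open>
  The extended meaning of \<open>p\<^sup>2 | D \<epsilon> n m\<close> for arbitrary integers \<open>n\<close>, \<open>m\<close>. That the choice of the
  positive representatives is irrelevant is the lemma \<open>sq_dvd_D_iff\<close> below.
\<close>
definition sq_dvd_D :: "nat \<Rightarrow> int \<Rightarrow> int \<Rightarrow> int \<Rightarrow> bool" where
  "sq_dvd_D p \<epsilon> n m \<longleftrightarrow>
     (\<exists>n' m'. 0 < m' \<and> m' < n' \<and>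
        [int m' = m] (mod (int p * (int p - 1))) \<and> [int n' = n] (mod (int p * (int p - 1))) \<and>
        int p ^ 2 dvd D \<epsilon> n' m')"

text \<open>
  Powers modulo \<open>N\<close> with integer exponents. If \<open>k < 0\<close> and \<open>a\<close> is not invertible modulo \<open>N\<close>, the
  power does not exist; the value is then \<open>0\<close>, because \<open>modular_inverse N a = 0\<close>.
\<close>
definition mod_power :: "int \<Rightarrow> int \<Rightarrow> int \<Rightarrow> int" where
  "mod_power N a k = (if k \<ge> 0 then a ^ nat k else modular_inverse N a ^ nat (- k))"

definition pth_power_mod_sq :: "nat \<Rightarrow> int \<Rightarrow> bool" where
  "pth_power_mod_sq p x \<longleftrightarrow> (\<exists>a. [x = a ^ p] (mod (int p ^ 2)))"

definition nonzero_pth_power_mod_sq :: "nat \<Rightarrow> int \<Rightarrow> bool" where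
  "nonzero_pth_power_mod_sq p x \<longleftrightarrow> pth_power_mod_sq p x \<and> \<not> int p dvd x"

definition setA :: "nat \<Rightarrow> int \<Rightarrow> int \<Rightarrow> int set set" where
  "setA p m \<epsilon> = {residue_class (int p * (int p - 1)) n | n. sq_dvd_D p \<epsilon> n m}"

text \<open>
  If \<open>m < 0\<close> and \<open>p\<close> divides \<open>1 - x\<close>, then \<open>(1 - x)\<^sup>m\<close> does not exist, and the condition fails here as
  it should: the left-hand side of the congruence is a unit modulo \<open>p\<^sup>2\<close>, the right-hand side is \<open>0\<close>.
\<close>
definition in_B :: "nat \<Rightarrow> int \<Rightarrow> int \<Rightarrow> int \<Rightarrow> int \<Rightarrow> bool" where
  "in_B p m \<epsilon> x k \<longleftrightarrow> nonzero_pth_power_mod_sq p x \<and>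
     [mod_power (int p ^ 2) x k = - \<epsilon> * mod_power (int p ^ 2) (1 - x) m] (mod (int p ^ 2))"

definition setB :: "nat \<Rightarrow> int \<Rightarrow> int \<Rightarrow> (int set \<times> int set) set" where
  "setB p m \<epsilon> = {(residue_class (int p ^ 2) x, residue_class (int p - 1) k) | x k. in_B p m \<epsilon> x k}"

text \<open>
  \<open>alpha_val p m n P\<close>: the pair \<open>P\<close> of residue classes is a result of the recipe for \<open>\<alpha>\<close>, applied to
  the representative \<open>n\<close>. Here \<open>y\<close> ranges over the inverses of \<open>n\<close> modulo \<open>p\<close>, and \<open>x\<close> over the
  \<open>p\<close>th powers modulo \<open>p\<^sup>2\<close> with \<open>x \<equiv> 1 - m n\<^sup>-\<^sup>1\<close> modulo \<open>p\<close>. That there is exactly one result,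
  independent of \<open>n\<close>, is part of well-definedness.
\<close>
definition alpha_val :: "nat \<Rightarrow> int \<Rightarrow> int \<Rightarrow> int set \<times> int set \<Rightarrow> bool" where
  "alpha_val p m n P \<longleftrightarrow>
     (\<exists>y x. [n * y = 1] (mod (int p)) \<and> pth_power_mod_sq p x \<and> [x = 1 - m * y] (mod (int p)) \<and>
        P = (residue_class (int p ^ 2) x, residue_class (int p - 1) (m - n)))"

definition alpha :: "nat \<Rightarrow> int \<Rightarrow> int set \<Rightarrow> int set \<times> int set" where
  "alpha p m C = (THE P. \<exists>n\<in>C. alpha_val p m n P)"

text \<open>Likewise for \<open>\<beta>\<close>, where \<open>i\<close> ranges over the integer inverses of \<open>1 - x\<close> modulo \<open>p\<^sup>2\<close>.\<close>
definition beta_val :: "nat \<Rightarrow> int \<Rightarrow> int \<Rightarrow> int \<Rightarrow> int set \<Rightarrow> bool" where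
  "beta_val p m x k C \<longleftrightarrow>
     (\<exists>i. [(1 - x) * i = 1] (mod (int p ^ 2)) \<and>
        C = residue_class (int p * (int p - 1)) ((m - k) * int p - m * i * (int p - 1)))"

definition beta :: "nat \<Rightarrow> int \<Rightarrow> int set \<times> int set \<Rightarrow> int set" where
  "beta p m P = (THE C. \<exists>x\<in>fst P. \<exists>k\<in>snd P. beta_val p m x k C)"

definition alpha_well_defined :: "nat \<Rightarrow> int \<Rightarrow> int \<Rightarrow> bool" where
  "alpha_well_defined p m \<epsilon> \<longleftrightarrow>
     (\<forall>C\<in>setA p m \<epsilon>. \<exists>P\<in>setB p m \<epsilon>. \<forall>n\<in>C. \<forall>Q. alpha_val p m n Q \<longleftrightarrow> Q = P)"

definition beta_well_defined :: "nat \<Rightarrow> int \<Rightarrow> int \<Rightarrow> bool" where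
  "beta_well_defined p m \<epsilon> \<longleftrightarrow>
     (\<forall>P\<in>setB p m \<epsilon>. \<exists>C\<in>setA p m \<epsilon>. \<forall>x\<in>fst P. \<forall>k\<in>snd P. \<forall>Q. beta_val p m x k Q \<longleftrightarrow> Q = C)"


text \<open>
  The remaining lemmas show that \<open>sq_dvd_D\<close> and \<open>in_B\<close> do not depend on the choices of
  representatives.
\<close>

lemma power_add_cong_sq:
  fixes a d :: int
  shows "[(a + d) ^ Suc n = a ^ Suc n + int (Suc n) * d * a ^ n] (mod (d ^ 2))"
proof (induction n)
  case 0
  show ?case by simp
next
  case (Suc n)
  have "[(a + d) * (a + d) ^ Suc n = (a + d) * (a ^ Suc n + int (Suc n) * d * a ^ n)] (mod (d ^ 2))"
    by (intro cong_mult cong_refl Suc)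
  moreover have "(a + d) * (a ^ Suc n + int (Suc n) * d * a ^ n) =
      (a ^ Suc (Suc n) + int (Suc (Suc n)) * d * a ^ Suc n) + d ^ 2 * (int (Suc n) * a ^ n)"
    by (simp add: algebra_simps power2_eq_square)
  ultimately show ?case
    by (simp add: cong_def)
qed

lemma self_power_cong:
  fixes p a b :: nat
  assumes p: "prime p" and a: "a > 0" and b: "b > 0"
    and ab: "[int a = int b] (mod (int p * (int p - 1)))"
  shows "[int b ^ b = int a ^ a * (1 + (int b - int a))] (mod (int p ^ 2))"
proof -
  have pd: "int p dvd int b - int a"
    using ab by (metis cong_iff_dvd_diff cong_sym dvd_mult_left)
  show ?thesis
  proof (cases "p dvd b")
    case True
    then have "int p dvd int a" using pd
      by (metis dvd_diff_right_iff int_dvd_int_iff zdvd_zdiffD dvd_diff_commute)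
    then have pa: "p dvd a" by simp
    have "p ^ 2 dvd c ^ c" if "p dvd c" "c > 0" for c :: nat
    proof -
      have "c \<ge> 2" using that prime_ge_2_nat[OF p] dvd_imp_le by force
      then show ?thesis using that by (meson dvd_power_same le_imp_power_dvd dvd_trans)
    qed
    then have "int p ^ 2 dvd int b ^ b" "int p ^ 2 dvd int a ^ a"
      using True pa a b by (metis of_nat_dvd_iff of_nat_power)+
    then show ?thesis by (simp add: cong_def mod_eq_0_iff_dvd)
  next
    case False
    then have cop: "coprime b (p ^ 2)"
      using prime_imp_coprime[OF p] by (simp add: coprime_commute)
    have tot: "int (totient (p ^ 2)) = int p * (int p - 1)"
      using totient_prime_power_Suc[OF p, of 1] prime_gt_0_nat[OF p]
      by (simp add: numeral_2_eq_2 of_nat_diff)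
    have e: "[b = a] (mod (totient (p ^ 2)))"
      using ab by (metis cong_int_iff cong_sym tot)
    have "[b ^ b = b ^ a] (mod (p ^ 2))"
      using e cop by (meson cong_dvd_modulus_nat coprime_commute order_divides_expdiff order_divides_totient)
    then have 1: "[int b ^ b = int b ^ a] (mod (int p ^ 2))"
      by (metis cong_int_iff of_nat_power)
    obtain c where c: "a = Suc c" using a gr0_implies_Suc by blast
    define d where "d = int b - int a"
    have "[(int a + d) ^ Suc c = int a ^ Suc c + int (Suc c) * d * int a ^ c] (mod (d ^ 2))"
      by (rule power_add_cong_sq)
    then have "[int b ^ a = int a ^ a * (1 + d)] (mod (d ^ 2))"
      by (simp add: d_def c algebra_simps)
    moreover have "int p ^ 2 dvd d ^ 2"
      using pd d_def by (simp add: dvd_power_same)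
    ultimately have "[int b ^ a = int a ^ a * (1 + d)] (mod (int p ^ 2))"
      using cong_dvd_modulus by blast
    then show ?thesis using 1 cong_trans d_def by blast
  qed
qed

lemma sq_dvd_D_step:
  fixes p n m n' m' :: nat
  assumes p: "prime p" and "0 < m" "m < n" "0 < m'" "m' < n'"
    and m: "[int m = int m'] (mod (int p * (int p - 1)))"
    and n: "[int n = int n'] (mod (int p * (int p - 1)))"
    and dvd: "int p ^ 2 dvd D \<epsilon> n m"
  shows "int p ^ 2 dvd D \<epsilon> n' m'"
proof -
  define b b' where "b = n - m" and "b' = n' - m'"
  have b: "[int b = int b'] (mod (int p * (int p - 1)))"
    using cong_diff[OF n m] assms by (simp add: b_def b'_def of_nat_diff)
  define e f where "e = int b' - int b" and "f = int m' - int m"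
  have ef: "int n' - int n = e + f"
    using assms by (simp add: e_def f_def b_def b'_def of_nat_diff)
  have N: "[int n' ^ n' = int n ^ n * (1 + (e + f))] (mod (int p ^ 2))"
    using self_power_cong[OF p _ _ n] assms ef by simp
  have B: "[int b' ^ b' = int b ^ b * (1 + e)] (mod (int p ^ 2))"
    using self_power_cong[OF p _ _ b] assms by (simp add: e_def b_def b'_def)
  have M: "[int m' ^ m' = int m ^ m * (1 + f)] (mod (int p ^ 2))"
    using self_power_cong[OF p _ _ m] assms by (simp add: f_def)
  have "int p dvd e" "int p dvd f"
    using b m unfolding e_def f_def by (metis cong_iff_dvd_diff cong_sym dvd_mult_left)+
  then have "int p ^ 2 dvd e * f" by (simp add: power2_eq_square mult_dvd_mono)
  then obtain t where t: "e * f = int p ^ 2 * t" by blast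
  have "[D \<epsilon> n' m' = int n ^ n * (1 + (e + f)) + \<epsilon> * (int b ^ b * (1 + e)) * (int m ^ m * (1 + f))]
          (mod (int p ^ 2))"
    unfolding D_def b'_def[symmetric] by (intro cong_add cong_mult cong_refl N B M)
  moreover have "int n ^ n * (1 + (e + f)) + \<epsilon> * (int b ^ b * (1 + e)) * (int m ^ m * (1 + f))
      = D \<epsilon> n m * (1 + (e + f)) + int p ^ 2 * (t * \<epsilon> * int b ^ b * int m ^ m)"
  proof -
    have "(1 + e) * (1 + f) = 1 + (e + f) + int p ^ 2 * t"
      using t by (simp add: algebra_simps)
    then have "\<epsilon> * (int b ^ b * (1 + e)) * (int m ^ m * (1 + f)) =
        \<epsilon> * int b ^ b * int m ^ m * (1 + (e + f) + int p ^ 2 * t)"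
      by (metis (no_types, opaque_lifting) mult.assoc mult.left_commute)
    then show ?thesis by (simp add: D_def b_def[symmetric] algebra_simps)
  qed
  ultimately show ?thesis using dvd
    by (metis cong_dvd_iff dvd_add dvd_mult2 dvd_triv_left)
qed

lemma sq_dvd_D_iff:
  fixes p n' m' :: nat and n m \<epsilon> :: int
  assumes "prime p" "0 < m'" "m' < n'"
    and "[int m' = m] (mod (int p * (int p - 1)))" "[int n' = n] (mod (int p * (int p - 1)))"
  shows "sq_dvd_D p \<epsilon> n m \<longleftrightarrow> int p ^ 2 dvd D \<epsilon> n' m'"
proof
  assume "sq_dvd_D p \<epsilon> n m"
  then show "int p ^ 2 dvd D \<epsilon> n' m'"
    unfolding sq_dvd_D_def using assms sq_dvd_D_step by (meson cong_sym cong_trans)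
next
  assume "int p ^ 2 dvd D \<epsilon> n' m'"
  then show "sq_dvd_D p \<epsilon> n m"
    unfolding sq_dvd_D_def using assms by blast
qed

lemma mod_power_cong_base:
  assumes "[x = x'] (mod N)"
  shows "[mod_power N x k = mod_power N x' k] (mod N)"
proof -
  have "[modular_inverse N x = modular_inverse N x'] (mod N)"
  proof (cases "coprime x N")
    case True
    then have c': "coprime x' N" using assms cong_imp_coprime by blast
    have "[x * modular_inverse N x = 1] (mod N)" using True by (rule cong_modular_inverse1)
    moreover have "[x * modular_inverse N x' = 1] (mod N)"
      using c' assms by (meson cong_modular_inverse1 cong_mult cong_refl cong_trans)
    ultimately show ?thesis
      using True by (meson cong_mult_lcancel cong_sym cong_trans)
  next
    case False
    then have "\<not> coprime x' N" using assms cong_imp_coprime cong_sym by blast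
    with False show ?thesis by (simp add: modular_inverse_def coprime_commute)
  qed
  then show ?thesis using assms by (simp add: mod_power_def cong_pow)
qed

lemma pth_power_order:
  fixes p :: nat
  assumes p: "prime p" and x: "nonzero_pth_power_mod_sq p x"
  shows "[x ^ (p - 1) = 1] (mod (int p ^ 2))"
proof -
  obtain a where a: "[x = a ^ p] (mod (int p ^ 2))" and nd: "\<not> int p dvd x"
    using x by (auto simp: nonzero_pth_power_mod_sq_def pth_power_mod_sq_def)
  have "[x = a ^ p] (mod (int p))"
    using a by (rule cong_dvd_modulus) (simp add: power2_eq_square)
  then have "\<not> int p dvd a"
    using nd p by (metis cong_dvd_iff dvd_power dvd_trans prime_gt_0_nat)
  then have cop: "coprime a (int p ^ 2)"
    using prime_imp_coprime[of "int p"] p by (simp add: coprime_commute)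
  define b where "b = nat (a mod int p ^ 2)"
  have b: "[int b = a] (mod (int p ^ 2))"
    using prime_gt_0_nat[OF p] by (simp add: b_def)
  then have "coprime (int b) (int p ^ 2)" using cop cong_imp_coprime cong_sym by blast
  then have "coprime b (p ^ 2)"
    by (metis coprime_int_iff of_nat_power)
  then have "[b ^ totient (p ^ 2) = 1] (mod (p ^ 2))" by (rule euler_theorem)
  moreover have "totient (p ^ 2) = p * (p - 1)"
    using totient_prime_power_Suc[OF p, of 1] by (simp add: numeral_2_eq_2)
  ultimately have "[int b ^ (p * (p - 1)) = 1] (mod (int p ^ 2))"
    by (metis cong_int_iff of_nat_1 of_nat_power)
  then have "[a ^ (p * (p - 1)) = 1] (mod (int p ^ 2))"
    using b by (meson cong_pow cong_sym cong_trans)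
  moreover have "[x ^ (p - 1) = (a ^ p) ^ (p - 1)] (mod (int p ^ 2))"
    using a by (rule cong_pow)
  ultimately show ?thesis by (metis cong_trans power_mult)
qed

lemma power_period:
  fixes x N :: int
  assumes "[x ^ q = 1] (mod N)"
  shows "[x ^ (r + q * t) = x ^ r] (mod N)"
proof -
  have "[(x ^ q) ^ t = 1 ^ t] (mod N)" using assms by (rule cong_pow)
  then have "[x ^ r * (x ^ q) ^ t = x ^ r * 1] (mod N)" by (intro cong_mult cong_refl) simp
  then show ?thesis by (simp add: power_add power_mult)
qed

lemma mod_power_reduce:
  fixes p :: nat
  assumes p: "prime p" and x: "nonzero_pth_power_mod_sq p x"
  shows "[mod_power (int p ^ 2) x k = x ^ nat (k mod (int p - 1))] (mod (int p ^ 2))"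
proof -
  define q where "q = p - 1"
  have q: "q > 0" "int p - 1 = int q" using prime_ge_2_nat[OF p] by (auto simp: q_def of_nat_diff)
  have per: "[x ^ q = 1] (mod (int p ^ 2))" using pth_power_order[OF p x] by (simp add: q_def)
  show ?thesis
  proof (cases "k \<ge> 0")
    case True
    then have "nat k = nat (k mod int q) + q * nat (k div int q)"
      using q by (metis mod_mult_div_eq nat_div_distrib nat_int nat_mod_distrib of_nat_0_le_iff)
    then show ?thesis
      using power_period[OF per] True by (metis mod_power_def q(2))
  next
    case False
    define y j r where "y = modular_inverse (int p ^ 2) x" and "j = nat (- k)"
      and "r = nat (k mod int q)"
    have "\<not> int p dvd x" using x by (simp add: nonzero_pth_power_mod_sq_def)
    then have "coprime x (int p ^ 2)"
      using prime_imp_coprime[of "int p"] p by (simp add: coprime_commute)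
    then have yx: "[y * x = 1] (mod (int p ^ 2))" unfolding y_def by (rule cong_modular_inverse2)
    have jr: "j + r = 0 + q * nat (- (k div int q))"
    proof -
      have "k div int q \<le> 0" using False q by (simp add: not_le pos_imp_zdiv_neg_iff order_less_imp_le)
      moreover have "0 \<le> k mod int q" using q by simp
      moreover have "k mod int q = k - int q * (k div int q)"
        by (rule minus_mult_div_eq_mod [symmetric])
      ultimately have "int (j + r) = int (0 + q * nat (- (k div int q)))"
        using False unfolding j_def r_def of_nat_add of_nat_mult by (simp add: int_nat_eq)
      then show ?thesis using of_nat_eq_iff by blast
    qed
    have "[x ^ (j + r) = 1] (mod (int p ^ 2))"
      unfolding jr using power_period[OF per, of 0] by simp
    then have "[y ^ j * x ^ (j + r) = y ^ j * 1] (mod (int p ^ 2))"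
      by (intro cong_mult cong_refl)
    moreover have "y ^ j * x ^ (j + r) = (y * x) ^ j * x ^ r"
      by (simp add: power_add power_mult_distrib)
    moreover have "[(y * x) ^ j * x ^ r = 1 ^ j * x ^ r] (mod (int p ^ 2))"
      using yx by (intro cong_mult cong_refl cong_pow)
    ultimately have "[y ^ j = x ^ r] (mod (int p ^ 2))"
      by (metis cong_sym cong_trans mult.right_neutral mult_1 power_one)
    then show ?thesis using False by (simp add: mod_power_def y_def j_def r_def q(2))
  qed
qed

lemma in_B_cong:
  fixes p :: nat
  assumes p: "prime p" and xx: "[x = x'] (mod (int p ^ 2))" and kk: "[k = k'] (mod (int p - 1))"
  shows "in_B p m \<epsilon> x k \<longleftrightarrow> in_B p m \<epsilon> x' k'"
proof -
  have step: "in_B p m \<epsilon> v l"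
    if uv: "[u = v] (mod (int p ^ 2))" and jl: "[j = l] (mod (int p - 1))" and B: "in_B p m \<epsilon> u j"
    for u v j l
  proof -
    have u: "nonzero_pth_power_mod_sq p u" using B by (simp add: in_B_def)
    have "[u = v] (mod (int p))"
      using uv by (rule cong_dvd_modulus) (simp add: power2_eq_square)
    then have v: "nonzero_pth_power_mod_sq p v"
      using u uv unfolding nonzero_pth_power_mod_sq_def pth_power_mod_sq_def
      by (meson cong_dvd_iff cong_dvd_modulus cong_sym cong_trans cong_iff_dvd_diff)
    let ?N = "int p ^ 2"
    have "[mod_power ?N v l = v ^ nat (l mod (int p - 1))] (mod ?N)"
      by (rule mod_power_reduce[OF p v])
    also have "l mod (int p - 1) = j mod (int p - 1)" using jl by (simp add: cong_def)
    also have "[v ^ nat (j mod (int p - 1)) = u ^ nat (j mod (int p - 1))] (mod ?N)"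
      using uv by (intro cong_pow) (rule cong_sym)
    also have "[u ^ nat (j mod (int p - 1)) = mod_power ?N u j] (mod ?N)"
      by (rule cong_sym[OF mod_power_reduce[OF p u]])
    also have "[mod_power ?N u j = - \<epsilon> * mod_power ?N (1 - u) m] (mod ?N)"
      using B by (simp add: in_B_def)
    also have "[- \<epsilon> * mod_power ?N (1 - u) m = - \<epsilon> * mod_power ?N (1 - v) m] (mod ?N)"
      using uv by (intro cong_mult cong_refl mod_power_cong_base cong_diff)
    finally show ?thesis using v by (simp add: in_B_def)
  qed
  show ?thesis using step xx kk cong_sym by blast
qed

end

theory Submission
  imports Defs
begin

text \<open>
  Let \<open>n > m > 0\<close> be prime to \<open>p\<close> and \<open>x \<equiv> 1 - m / n\<close> modulo \<open>p\<close>. Then \<open>n - m = x n + d\<close> and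
  \<open>m = (1 - x) n - d\<close> with \<open>p | d\<close>, and modulo \<open>p\<^sup>2\<close> the two self-powers pick up the factors \<open>1 + d\<close>
  and \<open>1 - d\<close>, which cancel. Hence \<open>D \<epsilon> n m \<equiv> n\<^sup>n (1 + \<epsilon> x\<^sup>n\<^sup>-\<^sup>m (1 - x)\<^sup>m)\<close>, so that \<open>p\<^sup>2\<close> divides
  \<open>D \<epsilon> n m\<close> iff \<open>x\<^sup>m\<^sup>-\<^sup>n \<equiv> -\<epsilon> (1 - x)\<^sup>m\<close>. Both maps are therefore described by one relation between \<open>n\<close>
  and \<open>(x, k)\<close>, namely \<open>n (1 - x) \<equiv> m\<close> modulo \<open>p\<close> and \<open>k \<equiv> m - n\<close> modulo \<open>p - 1\<close>. It determines
  \<open>n\<close> by the Chinese remainder theorem, and \<open>x\<close> because a \<open>p\<close>th power modulo \<open>p\<^sup>2\<close> is determined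
  by its residue modulo \<open>p\<close>.
\<close>

section \<open>Powers modulo \<open>p\<^sup>2\<close>\<close>

text \<open>Expand \<open>b ^ b\<close> around \<open>B\<close> to first order: the coefficient
  \<open>b\<close> of the linear term \<open>d * B ^ (b - 1)\<close> may be replaced by
  \<open>B\<close>, because \<open>b - B\<close> is the increment \<open>d\<close> itself and the
  square of \<open>d\<close> vanishes.\<close>

lemma self_power_cong_sq:
  fixes p b :: nat and B :: int
  assumes b: "b > 0" and cong: "[int b = B] (mod (int p))"
  shows "[int b ^ b = B ^ b * (1 + (int b - B))] (mod (int p ^ 2))"
proof -
  define d where "d = int b - B"
  have pd: "int p dvd d"
    using cong by (simp add: d_def cong_iff_dvd_diff)
  obtain c where c: "b = Suc c" using b gr0_implies_Suc by blast
  have "[(B + d) ^ Suc c = B ^ Suc c + int (Suc c) * d * B ^ c] (mod (d ^ 2))"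
    by (rule power_add_cong_sq)
  moreover have "int p ^ 2 dvd d ^ 2" using pd by (rule dvd_power_same)
  ultimately have "[int b ^ b = B ^ b + int b * d * B ^ c] (mod (int p ^ 2))"
    using cong_dvd_modulus by (metis add.commute c d_def diff_add_cancel)
  moreover have "B ^ b + int b * d * B ^ c = B ^ b * (1 + d) + d ^ 2 * B ^ c"
    unfolding c by (simp add: d_def c algebra_simps power2_eq_square)
  moreover have "[B ^ b * (1 + d) + d ^ 2 * B ^ c = B ^ b * (1 + d)] (mod (int p ^ 2))"
    using \<open>int p ^ 2 dvd d ^ 2\<close> by (simp add: cong_iff_dvd_diff)
  ultimately show ?thesis unfolding d_def by (metis cong_trans)
qed

lemma fermat_int:
  fixes a :: int
  assumes p: "prime p"
  shows "[a ^ p = a] (mod (int p))"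
proof (cases "int p dvd a")
  case True
  then have "int p dvd a ^ p"
    using prime_gt_0_nat[OF p] by (meson dvd_power dvd_trans)
  with True show ?thesis by (simp add: cong_def mod_eq_0_iff_dvd)
next
  case False
  define b where "b = nat (a mod int p)"
  have b: "[int b = a] (mod (int p))"
    using prime_gt_0_nat[OF p] by (simp add: b_def)
  then have "\<not> p dvd b" using False by (metis cong_dvd_iff int_dvd_int_iff)
  then have "[b ^ (p - 1) = 1] (mod p)" using p fermat_theorem by blast
  then have "[b * b ^ (p - 1) = b * 1] (mod p)" by (intro cong_mult cong_refl)
  moreover have "b * b ^ (p - 1) = b ^ p"
    using prime_gt_0_nat[OF p] by (metis power_eq_if not_gr_zero)
  ultimately have "[int b ^ p = int b] (mod (int p))"
    by (metis cong_int_iff mult.right_neutral of_nat_power)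
  then show ?thesis using b by (meson cong_pow cong_sym cong_trans)
qed

text \<open>In the binomial expansion the linear term gets one factor \<open>p\<close> from the
  exponent and one from \<open>a - b\<close>; all later terms contain the square of
  \<open>a - b\<close>.\<close>

lemma power_prime_cong_sq:
  fixes a b :: int
  assumes p: "prime p" and ab: "[a = b] (mod (int p))"
  shows "[a ^ p = b ^ p] (mod (int p ^ 2))"
proof -
  define d where "d = a - b"
  have pd: "int p dvd d" using ab by (simp add: d_def cong_iff_dvd_diff)
  obtain c where c: "p = Suc c" using prime_gt_0_nat[OF p] gr0_implies_Suc by blast
  have "[(b + d) ^ Suc c = b ^ Suc c + int (Suc c) * d * b ^ c] (mod (d ^ 2))"
    by (rule power_add_cong_sq)
  moreover have "int p ^ 2 dvd d ^ 2" using pd by (rule dvd_power_same)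
  ultimately have "[a ^ p = b ^ p + int p * d * b ^ c] (mod (int p ^ 2))"
    using cong_dvd_modulus by (metis add.commute c d_def diff_add_cancel)
  moreover have "int p ^ 2 dvd int p * d * b ^ c"
    using pd by (simp add: power2_eq_square mult_dvd_mono)
  then have "[b ^ p + int p * d * b ^ c = b ^ p] (mod (int p ^ 2))"
    by (simp add: cong_iff_dvd_diff)
  ultimately show ?thesis by (rule cong_trans)
qed

text \<open>By Fermat, \<open>a ^ p\<close> recovers \<open>a\<close> modulo \<open>p\<close>, so
  values congruent modulo \<open>p\<close> have congruent roots, and these have the same
  \<open>p\<close>th power modulo \<open>p ^ 2\<close>. The \<open>p\<close>th powers are thus the
  Teichmueller representatives modulo \<open>p ^ 2\<close>.\<close>

lemma pth_power_mod_sq_eqI: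
  assumes p: "prime p" and x: "pth_power_mod_sq p x" and x': "pth_power_mod_sq p x'"
    and xx': "[x = x'] (mod (int p))"
  shows "[x = x'] (mod (int p ^ 2))"
proof -
  obtain a b where a: "[x = a ^ p] (mod (int p ^ 2))" and b: "[x' = b ^ p] (mod (int p ^ 2))"
    using x x' by (auto simp: pth_power_mod_sq_def)
  have red: "[u = v] (mod (int p))" if "[u = v] (mod (int p ^ 2))" for u v
    using that by (rule cong_dvd_modulus) (simp add: power2_eq_square)
  have "[a = b] (mod (int p))"
    using red[OF a] red[OF b] xx' fermat_int[OF p] by (meson cong_sym cong_trans)
  then show ?thesis
    using a b power_prime_cong_sq[OF p] by (meson cong_sym cong_trans)
qed

lemma pth_power_mod_sq_cong:
  assumes "[x = x'] (mod (int p ^ 2))" "pth_power_mod_sq p x"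
  shows "pth_power_mod_sq p x'"
  using assms unfolding pth_power_mod_sq_def by (meson cong_sym cong_trans)

lemma pth_power_mod_sq_exists:
  assumes p: "prime p"
  obtains x where "pth_power_mod_sq p x" "[x = a] (mod (int p))"
  \<comment> \<open>The witness is \<open>a ^ p\<close>.\<close>
  using fermat_int[OF p] cong_refl unfolding pth_power_mod_sq_def by blast

section \<open>Integer exponents and Euler's theorem modulo \<open>p ^ 2\<close>\<close>

text \<open>Clears negative exponents: for \<open>a < b\<close>, \<open>b - a\<close> of the factors
  of \<open>x ^ b\<close> cancel against the inverse.\<close>

lemma mod_power_mult_power:
  assumes x: "coprime x N"
  shows "[mod_power N x (int a - int b) * x ^ b = x ^ a] (mod N)"
proof (cases "b \<le> a")
  case True
  then have "nat (int a - int b) = a - b" by simp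
  then show ?thesis using True
    by (simp add: mod_power_def flip: power_add)
next
  case False
  define j where "j = b - a"
  have j: "b = j + a" using False by (simp add: j_def)
  have "[modular_inverse N x * x = 1] (mod N)" using x by (rule cong_modular_inverse2)
  then have "[(modular_inverse N x * x) ^ j * x ^ a = 1 ^ j * x ^ a] (mod N)"
    by (intro cong_mult cong_pow cong_refl)
  moreover have "mod_power N x (int a - int b) = modular_inverse N x ^ j"
    using False j by (simp add: mod_power_def)
  ultimately show ?thesis by (simp add: j power_add power_mult_distrib mult.assoc)
qed

lemma dvd_mod_power:
  assumes "k \<noteq> 0" "int p dvd x" "int p dvd N" "p > 1"
  shows "int p dvd mod_power N x k"
proof (cases "k \<ge> 0")
  case True
  then have "0 < nat k" using \<open>k \<noteq> 0\<close> by simp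
  then have "int p dvd x ^ nat k" using \<open>int p dvd x\<close> by (meson dvd_power dvd_trans)
  with True show ?thesis by (simp add: mod_power_def)
next
  case False
  \<comment> \<open>For a negative exponent \<open>x\<close> has no inverse, and it is the default
    value 0 of \<open>modular_inverse\<close> that is divisible by \<open>p\<close>.\<close>
  have "\<not> is_unit (int p)" using \<open>p > 1\<close> by simp
  then have "\<not> coprime x N" using assms(2,3) not_coprimeI by blast
  then have "modular_inverse N x = 0" by (simp add: modular_inverse_def coprime_commute)
  with False show ?thesis by (simp add: mod_power_def power_0_left)
qed

lemma coprime_prime_sq_iff:
  assumes "prime p"
  shows "coprime x (int p ^ 2) \<longleftrightarrow> \<not> int p dvd x"
proof -
  have "prime (int p)" using assms by simp
  then have "coprime (int p) x \<longleftrightarrow> \<not> int p dvd x"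
    by (meson coprime_common_divisor dvd_refl not_prime_unit prime_imp_coprime)
  then show ?thesis by (simp add: coprime_commute)
qed

text \<open>\<open>x ^ p\<close> is a nonzero \<open>p\<close>th power, and the order of such a
  power divides \<open>p - 1\<close>.\<close>

lemma euler_prime_sq:
  fixes x :: int
  assumes p: "prime p" and x: "\<not> int p dvd x"
  shows "[x ^ (p * (p - 1)) = 1] (mod (int p ^ 2))"
proof -
  have "\<not> int p dvd x ^ p"
    using p x prime_dvd_power[of "int p" x p] by auto
  then have "nonzero_pth_power_mod_sq p (x ^ p)"
    unfolding nonzero_pth_power_mod_sq_def pth_power_mod_sq_def using cong_refl by blast
  from pth_power_order[OF p this] show ?thesis by (simp add: power_mult)
qed

lemma mod_power_cong_exponent:
  assumes p: "prime p" and x: "\<not> int p dvd x" and k: "[int a = k] (mod (int p * (int p - 1)))"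
  shows "[mod_power (int p ^ 2) x k = x ^ a] (mod (int p ^ 2))"
proof -
  let ?N = "int p ^ 2" and ?L = "p * (p - 1)"
  have cop: "coprime x ?N" using coprime_prime_sq_iff[OF p] x by blast
  have L: "int p * (int p - 1) = int ?L"
    using prime_gt_0_nat[OF p] by (simp add: of_nat_diff)
  obtain t where t: "k = int a + int ?L * t"
    using k unfolding L by (metis cong_iff_lin)
  \<comment> \<open>Writing \<open>t\<close> as a difference of naturals avoids a case distinction
    on its sign; both shifts are multiples of the period.\<close>
  define r s where "r = nat t" and "s = nat (- t)"
  have "t = int r - int s" by (simp add: r_def s_def)
  then have "k = int (a + ?L * r) - int (?L * s)"
    using t by (simp add: right_diff_distrib del: of_nat_diff)
  then have "[mod_power ?N x k * x ^ (?L * s) = x ^ (a + ?L * r)] (mod ?N)"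
    using mod_power_mult_power[OF cop] by metis
  moreover have "[x ^ (a + ?L * r) = x ^ a] (mod ?N)"
    using power_period[OF euler_prime_sq[OF p x]] .
  moreover have "[x ^ (?L * s) = 1] (mod ?N)"
    using power_period[OF euler_prime_sq[OF p x], of 0] by simp
  then have "[mod_power ?N x k * x ^ (?L * s) = mod_power ?N x k * 1] (mod ?N)"
    by (intro cong_mult cong_refl)
  ultimately show ?thesis by (metis cong_sym cong_trans mult.right_neutral)
qed

section \<open>The correspondence\<close>

text \<open>An inverse-free form that serves both directions: solved for \<open>x\<close>, the
  middle congruence is the recipe of \<alpha>; solved for \<open>n\<close>, it is the residue modulo
  \<open>p\<close> of the formula for \<beta>.\<close>

definition corresponds :: "nat \<Rightarrow> int \<Rightarrow> int \<Rightarrow> int \<Rightarrow> int \<Rightarrow> bool" where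
  "corresponds p m n x k \<longleftrightarrow> pth_power_mod_sq p x \<and> [n * (1 - x) = m] (mod (int p)) \<and>
     [k = m - n] (mod (int p - 1))"

lemma corresponds_not_dvd:
  assumes "corresponds p m n x k" "\<not> int p dvd m"
  shows "\<not> int p dvd n" "\<not> int p dvd 1 - x"
  using assms by (auto simp: corresponds_def dest: cong_dvd_iff)

section \<open>Divisibility of \<open>D\<close> expressed through \<open>x\<close>\<close>

lemma D_cong_sq:
  fixes p n m :: nat and x \<epsilon> :: int
  assumes "0 < m" "m < n" and x: "[int n * (1 - x) = int m] (mod (int p))"
  shows "[D \<epsilon> n m = int n ^ n * (1 + \<epsilon> * x ^ (n - m) * (1 - x) ^ m)] (mod (int p ^ 2))"
proof -
  define b where "b = n - m"
  define B M where "B = int n * x" and "M = int n * (1 - x)"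
  define d where "d = int b - B"
  have n: "int n = int b + int m" "n = b + m" using assms by (auto simp: b_def)
  \<comment> \<open>\<open>B + M = n = b + m\<close>, so the two errors are opposite and cancel
    below to first order.\<close>
  have d': "int m - M = - d" using n by (simp add: d_def B_def M_def algebra_simps)
  have pd: "int p dvd d"
    using x d' by (metis M_def cong_iff_dvd_diff cong_sym dvd_minus_iff)
  have "[int b ^ b = B ^ b * (1 + d)] (mod (int p ^ 2))"
    unfolding d_def using pd assms
    by (intro self_power_cong_sq) (auto simp: b_def d_def cong_iff_dvd_diff)
  moreover have "[int m ^ m = M ^ m * (1 + (- d))] (mod (int p ^ 2))"
    unfolding d'[symmetric] using x assms
    by (intro self_power_cong_sq) (auto simp: M_def cong_sym)
  ultimately have "[D \<epsilon> n m = int n ^ n + \<epsilon> * (B ^ b * (1 + d)) * (M ^ m * (1 + (- d)))]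
      (mod (int p ^ 2))"
    unfolding D_def b_def[symmetric] by (intro cong_add cong_mult cong_refl)
  moreover have "int n ^ n + \<epsilon> * (B ^ b * (1 + d)) * (M ^ m * (1 + (- d)))
      = int n ^ n + \<epsilon> * B ^ b * M ^ m - d ^ 2 * (\<epsilon> * B ^ b * M ^ m)"
    by (simp add: algebra_simps power2_eq_square)
  moreover have "int n ^ n + \<epsilon> * B ^ b * M ^ m = int n ^ n * (1 + \<epsilon> * x ^ b * (1 - x) ^ m)"
  proof -
    have "int n ^ n = int n ^ b * int n ^ m" using n(2) by (metis power_add)
    then show ?thesis
      by (simp add: B_def M_def power_mult_distrib distrib_left mult_ac)
  qed
  moreover have "int p ^ 2 dvd d ^ 2" using pd by (rule dvd_power_same)
  then have "[X - d ^ 2 * Y = X] (mod (int p ^ 2))" for X Y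
    by (simp add: cong_iff_dvd_diff)
  ultimately show ?thesis unfolding b_def by (metis cong_trans)
qed

text \<open>Multiplying the congruence in \<open>in_B\<close> by the unit
  \<open>x ^ (n' - m')\<close> clears the negative exponent. If \<open>p\<close> divides
  \<open>x\<close> or \<open>1 - x\<close>, both sides of the equivalence are false.\<close>

lemma in_B_iff_dvd:
  fixes p n' m' :: nat
  assumes p: "prime p" and \<epsilon>: "\<epsilon> \<in> {1, -1}" and m0: "\<not> int p dvd m"
    and pos: "0 < m'" "m' < n'"
    and m: "[int m' = m] (mod (int p * (int p - 1)))"
    and k: "[k = int m' - int n'] (mod (int p - 1))"
    and x: "pth_power_mod_sq p x"
  shows "in_B p m \<epsilon> x k \<longleftrightarrow> int p ^ 2 dvd 1 + \<epsilon> * x ^ (n' - m') * (1 - x) ^ m'"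
    (is "_ \<longleftrightarrow> ?N dvd 1 + \<epsilon> * x ^ ?b * _")
proof -
  have pp: "prime (int p)" using p by simp
  show ?thesis
  proof (cases "int p dvd x \<or> int p dvd 1 - x")
    case True
    have "int p dvd x ^ ?b \<or> int p dvd (1 - x) ^ m'"
      using True pos by (meson dvd_power dvd_trans zero_less_diff)
    then have dvd: "int p dvd \<epsilon> * x ^ ?b * (1 - x) ^ m'" by auto
    \<comment> \<open>The sum is congruent to 1 modulo \<open>p\<close> here.\<close>
    have R: "\<not> ?N dvd 1 + \<epsilon> * x ^ ?b * (1 - x) ^ m'"
    proof
      assume "?N dvd 1 + \<epsilon> * x ^ ?b * (1 - x) ^ m'"
      then have "int p dvd 1 + \<epsilon> * x ^ ?b * (1 - x) ^ m'"
        by (metis dvd_mult_left power2_eq_square)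
      then have "int p dvd 1" using dvd by (simp add: dvd_add_left_iff)
      then show False using pp not_prime_unit by blast
    qed
    have "\<not> in_B p m \<epsilon> x k"
    proof
      assume B: "in_B p m \<epsilon> x k"
      then have nz: "nonzero_pth_power_mod_sq p x" and
        eq: "[mod_power ?N x k = - \<epsilon> * mod_power ?N (1 - x) m] (mod ?N)"
        by (auto simp: in_B_def)
      then have nx: "\<not> int p dvd x" by (simp add: nonzero_pth_power_mod_sq_def)
      with True have "int p dvd 1 - x" by blast
      \<comment> \<open>\<open>m\<close> is nonzero because \<open>p\<close> does not divide it. So
        the right-hand side of \<open>eq\<close> is divisible by \<open>p\<close>, while its
        left-hand side is congruent to a power of \<open>x\<close>.\<close>
      then have "int p dvd mod_power ?N (1 - x) m"
        using m0 prime_gt_1_nat[OF p] by (intro dvd_mod_power) auto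
      moreover have "[x ^ nat (k mod (int p - 1)) = - \<epsilon> * mod_power ?N (1 - x) m] (mod ?N)"
        using eq mod_power_reduce[OF p nz] by (meson cong_sym cong_trans)
      then have "[x ^ nat (k mod (int p - 1)) = - \<epsilon> * mod_power ?N (1 - x) m] (mod (int p))"
        by (rule cong_dvd_modulus) simp
      ultimately have "int p dvd x ^ nat (k mod (int p - 1))"
        by (simp add: cong_dvd_iff)
      then show False using nx pp prime_dvd_power by blast
    qed
    with R show ?thesis by blast
  next
    case False
    then have nz: "nonzero_pth_power_mod_sq p x" and nx: "\<not> int p dvd x"
      and n1: "\<not> int p dvd 1 - x"
      using x by (auto simp: nonzero_pth_power_mod_sq_def)
    have cop: "coprime x ?N" using coprime_prime_sq_iff[OF p] nx by blast
    \<comment> \<open>\<open>u\<close> stands for \<open>x\<close> to the exponent \<open>k\<close>,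
      reduced modulo \<open>p - 1\<close>, and \<open>v\<close> is its inverse.\<close>
    define u v where "u = mod_power ?N x (int 0 - int ?b)" and "v = x ^ ?b"
    have uv: "[u * v = 1] (mod ?N)"
      unfolding u_def v_def using mod_power_mult_power[OF cop, of 0 ?b] by simp
    have copv: "coprime v ?N" using cop by (simp add: v_def)
    have e2: "\<epsilon> * \<epsilon> = 1" using \<epsilon> by auto
    have "int m' - int n' = int 0 - int ?b" using pos by (simp add: of_nat_diff)
    then have "[k = int 0 - int ?b] (mod (int p - 1))" using k by (rule subst)
    then have "in_B p m \<epsilon> x k \<longleftrightarrow> in_B p m \<epsilon> x (int 0 - int ?b)"
      by (intro in_B_cong[OF p] cong_refl)
    also have "\<dots> \<longleftrightarrow> [u = - \<epsilon> * mod_power ?N (1 - x) m] (mod ?N)"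
      using nz by (simp add: in_B_def u_def)
    also have "\<dots> \<longleftrightarrow> [u = - \<epsilon> * (1 - x) ^ m'] (mod ?N)"
    proof -
      have "[- \<epsilon> * mod_power ?N (1 - x) m = - \<epsilon> * (1 - x) ^ m'] (mod ?N)"
        by (intro cong_mult cong_refl mod_power_cong_exponent p n1 m)
      then show ?thesis by (meson cong_sym cong_trans)
    qed
    also have "\<dots> \<longleftrightarrow> [u * v = - \<epsilon> * (1 - x) ^ m' * v] (mod ?N)"
      using cong_mult_rcancel[OF copv] by blast
    also have "\<dots> \<longleftrightarrow> [1 = - \<epsilon> * (1 - x) ^ m' * v] (mod ?N)"
      using uv by (meson cong_sym cong_trans)
    also have "\<dots> \<longleftrightarrow> ?N dvd 1 + \<epsilon> * v * (1 - x) ^ m'"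
      by (simp add: cong_iff_dvd_diff mult_ac)
    finally show ?thesis by (simp add: v_def)
  qed
qed

lemma positive_representatives:
  fixes p :: nat
  assumes p: "prime p"
  obtains n' m' :: nat where "0 < m'" "m' < n'"
    "[int m' = m] (mod (int p * (int p - 1)))" "[int n' = n] (mod (int p * (int p - 1)))"
proof -
  define L where "L = int p * (int p - 1)"
  have L: "L > 0" using prime_gt_1_nat[OF p] by (simp add: L_def)
  \<comment> \<open>One added period makes \<open>m'\<close> positive and keeps it below
    \<open>2 * L\<close>; two added periods lift \<open>n'\<close> above it.\<close>
  define m' n' where "m' = nat (m mod L + L)" and "n' = nat (n mod L + 2 * L)"
  have "0 \<le> m mod L" "m mod L < L" "0 \<le> n mod L" using L by simp_all
  then have *: "int m' = m mod L + L" "int n' = n mod L + 2 * L" "0 < m'" "m' < n'"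
    using L unfolding m'_def n'_def by linarith+
  moreover have "[int m' = m] (mod L)" "[int n' = n] (mod L)"
    using * by (auto simp: cong_def)
  ultimately show ?thesis using that L_def by blast
qed

text \<open>For positive representatives, \<open>D\<close> is congruent to the expression of
  \<open>in_B_iff_dvd\<close> times \<open>n' ^ n'\<close>, a unit since \<open>p\<close> does not
  divide \<open>n\<close>. This is why each map lands in the domain of the other.\<close>

lemma corresponds_sq_dvd_D_iff:
  assumes p: "prime p" and m0: "\<not> int p dvd m" and \<epsilon>: "\<epsilon> \<in> {1, -1}"
    and cor: "corresponds p m n x k"
  shows "sq_dvd_D p \<epsilon> n m \<longleftrightarrow> in_B p m \<epsilon> x k"
proof -
  obtain n' m' :: nat where pos: "0 < m'" "m' < n'"
    and m: "[int m' = m] (mod (int p * (int p - 1)))"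
    and n: "[int n' = n] (mod (int p * (int p - 1)))"
    using positive_representatives[OF p] by blast
  have mp: "[int m' = m] (mod (int p))" "[int m' = m] (mod (int p - 1))"
    and np: "[int n' = n] (mod (int p))" "[int n' = n] (mod (int p - 1))"
    using m n by (auto intro: cong_dvd_modulus)
  have x: "pth_power_mod_sq p x" and nx: "[n * (1 - x) = m] (mod (int p))"
    and k: "[k = m - n] (mod (int p - 1))" using cor by (auto simp: corresponds_def)
  have "[int n' * (1 - x) = n * (1 - x)] (mod (int p))"
    using np by (intro cong_mult cong_refl)
  then have nx': "[int n' * (1 - x) = int m'] (mod (int p))"
    using nx mp by (meson cong_sym cong_trans)
  have k': "[k = int m' - int n'] (mod (int p - 1))"
    using k mp np by (meson cong_diff cong_sym cong_trans)
  have "\<not> int p dvd int n'"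
    using corresponds_not_dvd(1)[OF cor m0] np(1) cong_dvd_iff by blast
  then have "coprime (int n' ^ n') (int p ^ 2)"
    using coprime_prime_sq_iff[OF p] coprime_power_left_iff by blast
  have "sq_dvd_D p \<epsilon> n m \<longleftrightarrow> int p ^ 2 dvd D \<epsilon> n' m'"
    using sq_dvd_D_iff[OF p pos m n] .
  also have "\<dots> \<longleftrightarrow> int p ^ 2 dvd int n' ^ n' * (1 + \<epsilon> * x ^ (n' - m') * (1 - x) ^ m')"
    using D_cong_sq[OF pos nx'] by (rule cong_dvd_iff)
  also have "\<dots> \<longleftrightarrow> int p ^ 2 dvd 1 + \<epsilon> * x ^ (n' - m') * (1 - x) ^ m'"
    using \<open>coprime (int n' ^ n') (int p ^ 2)\<close>
    by (simp add: coprime_commute coprime_dvd_mult_right_iff)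
  also have "\<dots> \<longleftrightarrow> in_B p m \<epsilon> x k"
    using in_B_iff_dvd[OF p \<epsilon> m0 pos m k' x] by simp
  finally show ?thesis .
qed

section \<open>Change of representatives and uniqueness of partners\<close>

lemma corresponds_cong_left:
  assumes n: "[n = n'] (mod (int p * (int p - 1)))" and cor: "corresponds p m n x k"
  shows "corresponds p m n' x k"
proof -
  have np: "[n = n'] (mod (int p))" "[n = n'] (mod (int p - 1))"
    using n by (auto intro: cong_dvd_modulus)
  have "[n' * (1 - x) = n * (1 - x)] (mod (int p))"
    using np(1) by (intro cong_mult cong_refl) (rule cong_sym)
  moreover have "[m - n = m - n'] (mod (int p - 1))"
    using np by (intro cong_diff cong_refl)
  ultimately show ?thesis using cor unfolding corresponds_def by (meson cong_trans)
qed

lemma corresponds_cong_right: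
  assumes x: "[x = x'] (mod (int p ^ 2))" and k: "[k = k'] (mod (int p - 1))"
    and cor: "corresponds p m n x k"
  shows "corresponds p m n x' k'"
proof -
  have "[x' = x] (mod (int p))"
    using cong_sym[OF x] by (rule cong_dvd_modulus) simp
  then have "[n * (1 - x') = n * (1 - x)] (mod (int p))"
    by (intro cong_mult cong_diff cong_refl)
  then show ?thesis using cor k pth_power_mod_sq_cong[OF x] unfolding corresponds_def
    by (meson cong_trans cong_sym)
qed

lemma corresponds_unique_right:
  assumes p: "prime p" and m0: "\<not> int p dvd m"
    and c: "corresponds p m n x k" and c': "corresponds p m n x' k'"
  shows "[x = x'] (mod (int p ^ 2))" "[k = k'] (mod (int p - 1))"
proof -
  have "coprime n (int p)"
    using corresponds_not_dvd(1)[OF c m0] p prime_imp_coprime[of "int p" n]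
    by (simp add: coprime_commute)
  moreover have "[n * (1 - x) = n * (1 - x')] (mod (int p))"
    using c c' unfolding corresponds_def by (meson cong_sym cong_trans)
  ultimately have "[1 - x = 1 - x'] (mod (int p))" by (simp add: cong_mult_lcancel)
  from cong_diff[OF cong_refl[of 1] this] show "[x = x'] (mod (int p ^ 2))"
    using c c' by (intro pth_power_mod_sq_eqI p) (auto simp: corresponds_def)
  show "[k = k'] (mod (int p - 1))"
    using c c' unfolding corresponds_def by (meson cong_sym cong_trans)
qed

lemma corresponds_unique_left:
  assumes p: "prime p" and m0: "\<not> int p dvd m"
    and c: "corresponds p m n x k" and c': "corresponds p m n' x k"
  shows "[n = n'] (mod (int p * (int p - 1)))"
proof -
  have "coprime (1 - x) (int p)"
    using corresponds_not_dvd(2)[OF c m0] p prime_imp_coprime[of "int p" "1 - x"]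
    by (simp add: coprime_commute)
  moreover have "[n * (1 - x) = n' * (1 - x)] (mod (int p))"
    using c c' unfolding corresponds_def by (meson cong_sym cong_trans)
  ultimately have 1: "[n = n'] (mod (int p))" by (simp add: cong_mult_rcancel)
  have "[m - n = m - n'] (mod (int p - 1))"
    using c c' unfolding corresponds_def by (meson cong_sym cong_trans)
  from cong_diff[OF cong_refl[of m] this] have 2: "[n = n'] (mod (int p - 1))" by simp
  have "coprime (int p) (int p - 1)" by (metis coprime_commute coprime_diff_one_left)
  with 1 2 show ?thesis by (simp add: coprime_cong_mult)
qed

section \<open>The recipes for \<alpha> and \<beta> as partners under the correspondence\<close>

lemma residue_class_eq_iff: "residue_class N a = residue_class N b \<longleftrightarrow> [a = b] (mod N)"
  unfolding residue_class_def cong_def by auto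

text \<open>Every result of the recipe corresponds to \<open>n\<close>, so uniqueness of partners
  identifies it with the given pair. Conversely, multiplying \<open>n * (1 - x)\<close> by an
  inverse of \<open>n\<close> shows that the given \<open>x\<close> is itself a result.\<close>

lemma alpha_val_iff:
  assumes p: "prime p" and m0: "\<not> int p dvd m" and cor: "corresponds p m n x k"
  shows "alpha_val p m n Q \<longleftrightarrow> Q = (residue_class (int p ^ 2) x, residue_class (int p - 1) k)"
proof
  assume "alpha_val p m n Q"
  then obtain y x' where y: "[n * y = 1] (mod (int p))" and x': "pth_power_mod_sq p x'"
    "[x' = 1 - m * y] (mod (int p))"
    and Q: "Q = (residue_class (int p ^ 2) x', residue_class (int p - 1) (m - n))"
    unfolding alpha_val_def by blast
  have "[n * (1 - x') = n * (1 - (1 - m * y))] (mod (int p))"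
    using x' by (intro cong_mult cong_diff cong_refl)
  also have "n * (1 - (1 - m * y)) = m * (n * y)" by simp
  also have "[m * (n * y) = m * 1] (mod (int p))" using y by (intro cong_mult cong_refl)
  finally have "corresponds p m n x' (m - n)" using x' by (simp add: corresponds_def)
  from corresponds_unique_right[OF p m0 this cor]
  show "Q = (residue_class (int p ^ 2) x, residue_class (int p - 1) k)"
    by (simp add: Q residue_class_eq_iff)
next
  assume Q: "Q = (residue_class (int p ^ 2) x, residue_class (int p - 1) k)"
  have c: "pth_power_mod_sq p x" "[n * (1 - x) = m] (mod (int p))" "[k = m - n] (mod (int p - 1))"
    using cor by (auto simp: corresponds_def)
  have "coprime n (int p)"
    using corresponds_not_dvd(1)[OF cor m0] p prime_imp_coprime[of "int p" n]
    by (simp add: coprime_commute)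
  then obtain y where y: "[n * y = 1] (mod (int p))" using cong_solve_coprime_int by blast
  have "[y * (n * (1 - x)) = y * m] (mod (int p))" using c by (intro cong_mult cong_refl)
  moreover have "[(n * y) * (1 - x) = 1 * (1 - x)] (mod (int p))"
    using y by (intro cong_mult cong_refl)
  ultimately have "[1 - x = m * y] (mod (int p))"
    by (metis cong_sym cong_trans mult.assoc mult.commute mult_1)
  from cong_diff[OF cong_refl[of 1] this] have "[x = 1 - m * y] (mod (int p))" by simp
  then show "alpha_val p m n Q"
    using y c unfolding alpha_val_def Q
    by (intro exI[of _ y] exI[of _ x]) (auto simp: residue_class_eq_iff)
qed

text \<open>The formula is a Chinese remainder interpolation: modulo \<open>p\<close> the first term
  vanishes and \<open>p - 1\<close> is -1, leaving \<open>m * i\<close>; modulo \<open>p - 1\<close>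
  the second vanishes and \<open>p\<close> is 1, leaving \<open>m - k\<close>.\<close>

lemma corresponds_beta_formula:
  assumes x: "pth_power_mod_sq p x" and i: "[(1 - x) * i = 1] (mod (int p ^ 2))"
  shows "corresponds p m ((m - k) * int p - m * i * (int p - 1)) x k"
proof -
  have i': "[(1 - x) * i = 1] (mod (int p))"
    using i by (rule cong_dvd_modulus) simp
  have "((m - k) * int p - m * i * (int p - 1)) * (1 - x)
      = m * ((1 - x) * i) + int p * ((m - k - m * i) * (1 - x))"
    by (simp add: algebra_simps)
  also have "[\<dots> = m * 1 + 0] (mod (int p))"
    using i' by (intro cong_add cong_mult cong_refl) (simp_all add: cong_0_iff)
  finally have 1: "[((m - k) * int p - m * i * (int p - 1)) * (1 - x) = m] (mod (int p))"
    by simp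
  have "k - (m - ((m - k) * int p - m * i * (int p - 1))) = (int p - 1) * (m - k - m * i)"
    by (simp add: algebra_simps)
  then have "[k = m - ((m - k) * int p - m * i * (int p - 1))] (mod (int p - 1))"
    by (simp add: cong_iff_dvd_diff)
  with 1 x show ?thesis by (simp add: corresponds_def)
qed

lemma inverse_mod_prime_sq_exists:
  assumes p: "prime p" and "\<not> int p dvd u"
  obtains i where "[u * i = 1] (mod (int p ^ 2))"
  using assms coprime_prime_sq_iff[OF p] cong_solve_coprime_int by blast

text \<open>Whichever inverse \<open>i\<close> is taken, the formula yields a partner of
  \<open>(x, k)\<close>, and partners are unique; an inverse exists because \<open>1 - x\<close> is
  a unit.\<close>

lemma beta_val_iff:
  assumes p: "prime p" and m0: "\<not> int p dvd m" and cor: "corresponds p m n x k"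
  shows "beta_val p m x k Q \<longleftrightarrow> Q = residue_class (int p * (int p - 1)) n"
proof -
  have x: "pth_power_mod_sq p x" using cor by (simp add: corresponds_def)
  have "residue_class (int p * (int p - 1)) ((m - k) * int p - m * i * (int p - 1))
      = residue_class (int p * (int p - 1)) n" if "[(1 - x) * i = 1] (mod (int p ^ 2))" for i
    unfolding residue_class_eq_iff
    using corresponds_unique_left[OF p m0 corresponds_beta_formula[OF x that] cor] .
  moreover obtain i where "[(1 - x) * i = 1] (mod (int p ^ 2))"
    using inverse_mod_prime_sq_exists[OF p corresponds_not_dvd(2)[OF cor m0]] by blast
  ultimately show ?thesis unfolding beta_val_def by metis
qed

section \<open>Existence of partners\<close>

text \<open>If \<open>p\<close> divided \<open>n\<close>, it would divide neither \<open>m\<close>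
  nor \<open>n - m\<close>, so in \<open>D\<close> only the first summand would vanish modulo
  \<open>p\<close>. Hence \<open>n\<close> is invertible, and \<open>x\<close> is the
  \<open>p\<close>th power lifting \<open>1 - m / n\<close>.\<close>

lemma sq_dvd_D_imp_corresponds:
  assumes p: "prime p" and m0: "\<not> int p dvd m" and \<epsilon>: "\<epsilon> \<in> {1, -1}" and dvd: "sq_dvd_D p \<epsilon> n m"
  obtains x k where "corresponds p m n x k"
proof -
  have pp: "prime (int p)" using p by simp
  have "\<not> int p dvd n"
  proof
    assume pn: "int p dvd n"
    obtain n' m' :: nat where pos: "0 < m'" "m' < n'"
      and m: "[int m' = m] (mod (int p * (int p - 1)))"
      and n: "[int n' = n] (mod (int p * (int p - 1)))"
      and D: "int p ^ 2 dvd D \<epsilon> n' m'"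
      using dvd unfolding sq_dvd_D_def by blast
    have mp: "[int m' = m] (mod (int p))" and np: "[int n' = n] (mod (int p))"
      using m n by (auto intro: cong_dvd_modulus)
    have pn': "int p dvd int n'" and pm': "\<not> int p dvd int m'"
      using cong_dvd_iff[OF np] cong_dvd_iff[OF mp] pn m0 by blast+
    have pb: "\<not> int p dvd int (n' - m')"
    proof -
      have "int m' = int n' - int (n' - m')" using pos by simp
      then show ?thesis using pn' pm' dvd_diff by metis
    qed
    have "int p dvd D \<epsilon> n' m'" using D by (metis dvd_mult_left power2_eq_square)
    moreover have "int p dvd int n' ^ n'" using pn' pos
      by (meson dvd_power dvd_trans less_trans)
    ultimately have "int p dvd \<epsilon> * int (n' - m') ^ (n' - m') * int m' ^ m'"
      unfolding D_def by (simp add: dvd_add_right_iff)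
    then have "int p dvd int (n' - m') ^ (n' - m') \<or> int p dvd int m' ^ m'"
      using \<epsilon> prime_dvd_mult_iff[OF pp] by auto
    then show False using pb pm' prime_dvd_power[OF pp] by blast
  qed
  then have "coprime n (int p)"
    using prime_imp_coprime[OF pp] by (simp add: coprime_commute)
  then obtain y where y: "[n * y = 1] (mod (int p))" using cong_solve_coprime_int by blast
  obtain x where x: "pth_power_mod_sq p x" "[x = 1 - m * y] (mod (int p))"
    using pth_power_mod_sq_exists[OF p] by blast
  have "[n * (1 - x) = n * (1 - (1 - m * y))] (mod (int p))"
    using x by (intro cong_mult cong_diff cong_refl)
  also have "n * (1 - (1 - m * y)) = m * (n * y)" by simp
  also have "[m * (n * y) = m * 1] (mod (int p))" using y by (intro cong_mult cong_refl)
  finally have "corresponds p m n x (m - n)" using x by (simp add: corresponds_def)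
  then show ?thesis using that by blast
qed

text \<open>The point is that \<open>1 - x\<close> is a unit; the formula for \<beta> then supplies
  \<open>n\<close>.\<close>

lemma in_B_imp_corresponds:
  assumes p: "prime p" and m0: "\<not> int p dvd m" and \<epsilon>: "\<epsilon> \<in> {1, -1}" and B: "in_B p m \<epsilon> x k"
  obtains n where "corresponds p m n x k"
proof -
  have x: "pth_power_mod_sq p x"
    using B by (simp add: in_B_def nonzero_pth_power_mod_sq_def)
  \<comment> \<open>This \<open>n'\<close> is auxiliary: it represents \<open>m - k\<close> so that
    \<open>k\<close> is congruent to \<open>m' - n'\<close>, as the criterion for
    \<open>in_B\<close> requires.\<close>
  obtain n' m' :: nat where pos: "0 < m'" "m' < n'"
    and m: "[int m' = m] (mod (int p * (int p - 1)))"
    and n: "[int n' = m - k] (mod (int p * (int p - 1)))"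
    using positive_representatives[OF p, of m "m - k"] by blast
  have "[int m' - int n' = m - (m - k)] (mod (int p - 1))"
    using m n by (intro cong_diff) (auto intro: cong_dvd_modulus)
  then have "[k = int m' - int n'] (mod (int p - 1))" by (simp add: cong_sym)
  from in_B_iff_dvd[OF p \<epsilon> m0 pos m this x] B
  have dvd: "int p ^ 2 dvd 1 + \<epsilon> * x ^ (n' - m') * (1 - x) ^ m'" by simp
  have "\<not> int p dvd 1 - x"
  proof
    assume "int p dvd 1 - x"
    then have "int p dvd (1 - x) ^ m'" using pos by (meson dvd_power dvd_trans)
    moreover have "int p dvd 1 + \<epsilon> * x ^ (n' - m') * (1 - x) ^ m'"
      using dvd by (metis dvd_mult_left power2_eq_square)
    ultimately have "int p dvd 1" by (simp add: dvd_add_left_iff)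
    then show False using prime_gt_1_nat[OF p] by simp
  qed
  then obtain i where "[(1 - x) * i = 1] (mod (int p ^ 2))"
    using inverse_mod_prime_sq_exists[OF p] by blast
  then show ?thesis using corresponds_beta_formula[OF x] that by blast
qed

section \<open>Values of the maps on residue classes, and the bijection\<close>

lemma alpha_residue_class:
  assumes "prime p" "\<not> int p dvd m" and cor: "corresponds p m n x k"
  shows "alpha p m (residue_class (int p * (int p - 1)) n)
    = (residue_class (int p ^ 2) x, residue_class (int p - 1) k)"
proof -
  have "alpha_val p m n' Q \<longleftrightarrow> Q = (residue_class (int p ^ 2) x, residue_class (int p - 1) k)"
    if "n' \<in> residue_class (int p * (int p - 1)) n" for n' Q
    using that cor assms(1,2) corresponds_cong_left alpha_val_iff
    by (metis cong_sym mem_Collect_eq residue_class_def)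
  moreover have "n \<in> residue_class (int p * (int p - 1)) n" by (simp add: residue_class_def)
  ultimately show ?thesis unfolding alpha_def by (intro the_equality) blast+
qed

lemma beta_residue_class:
  assumes "prime p" "\<not> int p dvd m" and cor: "corresponds p m n x k"
  shows "beta p m (residue_class (int p ^ 2) x, residue_class (int p - 1) k)
    = residue_class (int p * (int p - 1)) n"
proof -
  have "beta_val p m x' k' Q \<longleftrightarrow> Q = residue_class (int p * (int p - 1)) n"
    if "x' \<in> residue_class (int p ^ 2) x" "k' \<in> residue_class (int p - 1) k" for x' k' Q
    using that cor assms(1,2) corresponds_cong_right beta_val_iff
    by (metis cong_sym mem_Collect_eq residue_class_def)
  moreover have "x \<in> residue_class (int p ^ 2) x" "k \<in> residue_class (int p - 1) k"
    by (auto simp: residue_class_def)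
  ultimately show ?thesis unfolding beta_def fst_conv snd_conv by (intro the_equality) blast+
qed

theorem theorem3p6:
  fixes p :: nat and m \<epsilon> :: int
  assumes "prime p" and "odd p" and "\<not> int p dvd m" and "\<epsilon> \<in> {1, -1}"
  shows "alpha_well_defined p m \<epsilon> \<and> beta_well_defined p m \<epsilon> \<and>
    (\<forall>C\<in>setA p m \<epsilon>. beta p m (alpha p m C) = C) \<and>
    (\<forall>P\<in>setB p m \<epsilon>. alpha p m (beta p m P) = P) \<and>
    bij_betw (alpha p m) (setA p m \<epsilon>) (setB p m \<epsilon>) \<and>
    bij_betw (beta p m) (setB p m \<epsilon>) (setA p m \<epsilon>)"
proof -
  note p = assms(1) and m0 = assms(3) and \<epsilon> = assms(4)
  let ?cA = "residue_class (int p * (int p - 1))"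
  let ?cB = "\<lambda>x k. (residue_class (int p ^ 2) x, residue_class (int p - 1) k)"
  \<comment> \<open>\<open>A\<close> and \<open>B\<close> present each element of either set as one
    side of a corresponding pair whose other side lies in the other set; all claims are then read
    off from such pairs.\<close>
  have A: "\<exists>n x k. C = ?cA n \<and> corresponds p m n x k \<and> ?cB x k \<in> setB p m \<epsilon>"
    if C: "C \<in> setA p m \<epsilon>" for C
  proof -
    obtain n where n: "C = ?cA n" "sq_dvd_D p \<epsilon> n m" using C by (auto simp: setA_def)
    obtain x k where cor: "corresponds p m n x k"
      using sq_dvd_D_imp_corresponds[OF p m0 \<epsilon> n(2)] by blast
    then have "in_B p m \<epsilon> x k" using corresponds_sq_dvd_D_iff[OF p m0 \<epsilon>] n(2) by blast
    with n cor show ?thesis unfolding setB_def by blast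
  qed
  have B: "\<exists>n x k. P = ?cB x k \<and> corresponds p m n x k \<and> ?cA n \<in> setA p m \<epsilon>"
    if P: "P \<in> setB p m \<epsilon>" for P
  proof -
    obtain x k where xk: "P = ?cB x k" "in_B p m \<epsilon> x k" using P by (auto simp: setB_def)
    obtain n where cor: "corresponds p m n x k"
      using in_B_imp_corresponds[OF p m0 \<epsilon> xk(2)] by blast
    then have "sq_dvd_D p \<epsilon> n m" using corresponds_sq_dvd_D_iff[OF p m0 \<epsilon>] xk(2) by blast
    with xk cor show ?thesis unfolding setA_def by blast
  qed
  have "alpha_well_defined p m \<epsilon>"
    unfolding alpha_well_defined_def
  proof
    fix C assume "C \<in> setA p m \<epsilon>"
    then obtain n x k where C: "C = ?cA n" and cor: "corresponds p m n x k"
      and P: "?cB x k \<in> setB p m \<epsilon>" using A by blast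
    \<comment> \<open>Each representative \<open>n'\<close> of \<open>C\<close> corresponds to the
      same \<open>(x, k)\<close>, so the result is independent of the choice.\<close>
    have "alpha_val p m n' Q \<longleftrightarrow> Q = ?cB x k" if "n' \<in> C" for n' Q
      using that alpha_val_iff[OF p m0 corresponds_cong_left[OF _ cor], of n' Q]
      by (simp add: C residue_class_def cong_sym)
    with P show "\<exists>P\<in>setB p m \<epsilon>. \<forall>n\<in>C. \<forall>Q. alpha_val p m n Q \<longleftrightarrow> Q = P" by blast
  qed
  moreover have "beta_well_defined p m \<epsilon>"
    unfolding beta_well_defined_def
  proof
    fix P assume "P \<in> setB p m \<epsilon>"
    then obtain n x k where P: "P = ?cB x k" and cor: "corresponds p m n x k"
      and C: "?cA n \<in> setA p m \<epsilon>" using B by blast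
    have "beta_val p m x' k' Q \<longleftrightarrow> Q = ?cA n" if "x' \<in> fst P" "k' \<in> snd P" for x' k' Q
      using that beta_val_iff[OF p m0 corresponds_cong_right[OF _ _ cor], of x' k' Q]
      by (simp add: P residue_class_def cong_sym)
    with C show "\<exists>C\<in>setA p m \<epsilon>. \<forall>x\<in>fst P. \<forall>k\<in>snd P. \<forall>Q. beta_val p m x k Q \<longleftrightarrow> Q = C"
      by blast
  qed
  \<comment> \<open>\<alpha> and \<beta> traverse the same corresponding pair in opposite
    directions.\<close>
  moreover have ba: "\<forall>C\<in>setA p m \<epsilon>. beta p m (alpha p m C) = C"
    using A alpha_residue_class[OF p m0] beta_residue_class[OF p m0] by metis
  moreover have ab: "\<forall>P\<in>setB p m \<epsilon>. alpha p m (beta p m P) = P"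
    using B alpha_residue_class[OF p m0] beta_residue_class[OF p m0] by metis
  moreover have imA: "alpha p m ` setA p m \<epsilon> \<subseteq> setB p m \<epsilon>"
    using A alpha_residue_class[OF p m0] by (metis image_subsetI)
  moreover have imB: "beta p m ` setB p m \<epsilon> \<subseteq> setA p m \<epsilon>"
    using B beta_residue_class[OF p m0] by (metis image_subsetI)
  ultimately show ?thesis
    using bij_betw_byWitness[OF ba ab imA imB] bij_betw_byWitness[OF ab ba imB imA] by blast
qed

end
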